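(* Consider the OTFS-based random access (RA) receiver described in the context, with the rectangular receiver window $W_{rx}[n]=1$ for $n=0,1,\dots,N-1$, in the single-UT scenario. Let $M = 1+\lceil G B_c\rceil$ and $N = \left\lfloor \frac{B_c T_c}{1+\lceil G B_c\rceil}\right\rfloor$. For a desired false alarm probability $p_{fa}\in(0,1)$, the threshold $\mu$ achieving $P_{FA}=p_{fa}$ is $$\mu(p_{fa}) = -N_o\,(1+\lceil G B_c\rceil)\left\lfloor \frac{B_cT_c}{1+\lceil G B_c\rceil}\right\rfloor \log\left[1-(1-p_{fa})^{\frac{1}{N_1(1+\lceil G B_c\rceil)}}\right].$$
   Context: System parameters: $G>0$ is the maximum round-trip propagation delay in the cell, $B_c>0$ the bandwidth and $T_c>G$ the time allocated for RA preamble transmission. Set $M=1+\lceil GB_c\rceil$, $T=M/B_c$, $\Delta f=1/T$, $N=\lfloor T_c/T\rfloor$, and let $N_1$ be an integer with $1\le N_1\le N$. The delay-Doppler (DD) grid is $\{(k,l): k=0,\dots,N-1,\ l=0,\dots,M-1\}$, and the $q$-th RA preamble is allocated the DDRE group $\mathcal R_q=\{(k,l): 0\le l\le M-1,\ qN_1\le k<(q+1)N_1\}$ (so $|\mathcal R_q| = N_1 M$). At the base station the received signal is $r(t)$ = (sum of channel-distorted preambles) $+\,w(t)$, where $w(t)$ is complex white Gaussian noise of power spectral density $N_o$. The receiver computes, for $n=0,\dots,N-1$, $m=0,\dots,M-1$, $Y[n,m]=W_{rx}[n]\frac{1}{\sqrt T}\int_{nT}^{(n+1)T} r(t)e^{-j2\pi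 m\Delta f t}\,dt$ and then $\hat x[k,l]=\sum_{n=0}^{N-1}\sum_{m=0}^{M-1}Y[n,m]e^{j2\pi(ml/M-nk/N)}$. Its noise component is $w[k,l]=\sum_{n,m}W[n,m]e^{j2\pi(ml/M-nk/N)}$ with $W[n,m]=W_{rx}[n]\frac{1}{\sqrt T}\int_{nT}^{(n+1)T}w(t)e^{-j2\pi m\Delta f t}dt$. The detection statistic for preamble $q$ is $z_q=\max_{(k,l)\in\mathcal R_q}|\hat x[k,l]|^2$, and the false alarm probability for threshold $\mu$ is $P_{FA}=\Pr(z_q\ge\mu \mid q\text{-th preamble not transmitted})$; in the single-UT scenario, when the $q$-th preamble is not transmitted, the DD-domain signal on $\mathcal R_q$ is taken to be the noise $w[k,l]$ only, i.e. $P_{FA}=\Pr\big(\max_{(k,l)\in\mathcal R_q}|w[k,l]|^2\ge\mu\big)$. $\log$ is the natural logarithm. *)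

theory Defs
  imports "HOL-Probability.Probability"
begin

definition cgauss :: "'a measure \<Rightarrow> ('a \<Rightarrow> complex) \<Rightarrow> real \<Rightarrow> bool" where
  "cgauss P X s2 \<longleftrightarrow>
     distributed P lborel (\<lambda>\<omega>. Re (X \<omega>)) (normal_density 0 (sqrt (s2 / 2))) \<and>
     distributed P lborel (\<lambda>\<omega>. Im (X \<omega>)) (normal_density 0 (sqrt (s2 / 2))) \<and>
     prob_space.indep_var P borel (\<lambda>\<omega>. Re (X \<omega>)) borel (\<lambda>\<omega>. Im (X \<omega>))"

text \<open>Complex white Gaussian noise w(t) of power spectral density No, given through its
  projections: nf phi omega stands for the integral of w(t) * cnj(phi t) dt.
  White noise means: projections onto any finite orthonormal family (in L2 of the real line)
  are independent CN(0, No) random variables.\<close>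
definition white_noise :: "'a measure \<Rightarrow> ((real \<Rightarrow> complex) \<Rightarrow> 'a \<Rightarrow> complex) \<Rightarrow> real \<Rightarrow> bool" where
  "white_noise P nf No \<longleftrightarrow>
     (\<forall>(I::nat set) (\<phi>::nat \<Rightarrow> real \<Rightarrow> complex).
        finite I \<longrightarrow>
        (\<forall>i\<in>I. \<forall>j\<in>I. integrable lborel (\<lambda>t. \<phi> i t * cnj (\<phi> j t)) \<and>
                       (LINT t|lborel. \<phi> i t * cnj (\<phi> j t)) = (if i = j then 1 else 0)) \<longrightarrow>
        prob_space.indep_vars P (\<lambda>_. borel) (\<lambda>i. nf (\<phi> i)) I \<and>
        (\<forall>i\<in>I. cgauss P (nf (\<phi> i)) No))"

definition Msz :: "real \<Rightarrow> real \<Rightarrow> nat" where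
  "Msz G Bc = nat (1 + \<lceil>G * Bc\<rceil>)"

definition Tsym :: "real \<Rightarrow> real \<Rightarrow> real" where
  "Tsym G Bc = real (Msz G Bc) / Bc"

definition dfreq :: "real \<Rightarrow> real \<Rightarrow> real" where
  "dfreq G Bc = 1 / Tsym G Bc"

definition Nsz :: "real \<Rightarrow> real \<Rightarrow> real \<Rightarrow> nat" where
  "Nsz G Bc Tc = nat \<lfloor>Tc / Tsym G Bc\<rfloor>"

definition Rgrp :: "real \<Rightarrow> real \<Rightarrow> nat \<Rightarrow> nat \<Rightarrow> (nat \<times> nat) set" where
  "Rgrp G Bc N1 q = {(k, l). l < Msz G Bc \<and> q * N1 \<le> k \<and> k < (q + 1) * N1}"

text \<open>Noise in the TF domain:
  W[n,m] = Wrx[n] * (1/sqrt T) * integral_{nT}^{(n+1)T} w(t) exp(-j 2 pi m df t) dt,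
  where the real factor 1/sqrt T is moved inside the projection.\<close>
definition Wtf :: "((real \<Rightarrow> complex) \<Rightarrow> 'a \<Rightarrow> complex) \<Rightarrow> (nat \<Rightarrow> complex) \<Rightarrow> real \<Rightarrow> real
                   \<Rightarrow> nat \<Rightarrow> nat \<Rightarrow> 'a \<Rightarrow> complex" where
  "Wtf nf Wrx G Bc n m \<omega> = Wrx n *
     nf (\<lambda>t. indicator {real n * Tsym G Bc .. (real n + 1) * Tsym G Bc} t *
               exp (\<i> * complex_of_real (2 * pi * real m * dfreq G Bc * t))
               / complex_of_real (sqrt (Tsym G Bc))) \<omega>"

definition wdd :: "((real \<Rightarrow> complex) \<Rightarrow> 'a \<Rightarrow> complex) \<Rightarrow> (nat \<Rightarrow> complex) \<Rightarrow> real \<Rightarrow> real \<Rightarrow> real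
                   \<Rightarrow> nat \<Rightarrow> nat \<Rightarrow> 'a \<Rightarrow> complex" where
  "wdd nf Wrx G Bc Tc k l \<omega> =
     (\<Sum>n<Nsz G Bc Tc. \<Sum>m<Msz G Bc. Wtf nf Wrx G Bc n m \<omega> *
        exp (\<i> * complex_of_real (2 * pi * (real m * real l / real (Msz G Bc)
                                             - real n * real k / real (Nsz G Bc Tc)))))"

definition PFA :: "'a measure \<Rightarrow> ((real \<Rightarrow> complex) \<Rightarrow> 'a \<Rightarrow> complex) \<Rightarrow> (nat \<Rightarrow> complex)
                   \<Rightarrow> real \<Rightarrow> real \<Rightarrow> real \<Rightarrow> nat \<Rightarrow> nat \<Rightarrow> real \<Rightarrow> real" where
  "PFA P nf Wrx G Bc Tc N1 q \<mu> =
     measure P {\<omega> \<in> space P.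
        (MAX kl\<in>Rgrp G Bc N1 q. (cmod (wdd nf Wrx G Bc Tc (fst kl) (snd kl) \<omega>))\<^sup>2) \<ge> \<mu>}"

end

theory Submission
  imports Defs
begin

text \<open>
  A joint characteristic function that factorises forces independence: its exponentials can be
  replaced by indicators one coordinate at a time, each step being the one-dimensional
  uniqueness theorem applied to a density tilted by the remaining factors. Hence a
  family of independent circular Gaussians stays independent and Gaussian under any matrix with
  orthogonal rows of equal norm. The time-frequency pulses are orthonormal, so the projections of
  the white noise onto them form such a family, and the discrete Fourier matrix has orthogonal
  rows of squared norm $NM$; thus the noise samples on the DD grid are independent $CN(0, NMN_o)$. Their
  squared moduli are exponential with mean $NMN_o$, and the false alarm probability is
  $1 - (1 - e^{-\mu/(NMN_o)})^{N_1 M}$, which is solved for $\mu$.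
\<close>

subsection \<open>Independence from characteristic functions\<close>

text \<open>The real-weight step of the uniqueness argument. Tilting the measure by
  \<open>1 + U / c\<close> leaves the characteristic function of \<open>X\<close> unchanged, so by
  Levy's uniqueness theorem it leaves the law of \<open>X\<close> unchanged. Comparing the two
  probabilities of \<open>A\<close> isolates the integral of \<open>U\<close> over the
  event.\<close>

lemma (in prob_space) weighted_char_zero_real:
  fixes X U :: "'a \<Rightarrow> real"
  assumes X [measurable]: "X \<in> borel_measurable M" and U [measurable]: "U \<in> borel_measurable M"
    and bd: "\<And>\<omega>. \<bar>U \<omega>\<bar> \<le> B"
    and zero: "\<And>t. (CLINT \<omega>|M. of_real (U \<omega>) * iexp (t * X \<omega>)) = 0"
    and A [measurable]: "A \<in> sets borel"
  shows "(LINT \<omega>|M. U \<omega> * indicator A (X \<omega>)) = 0"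
proof -
  \<comment> \<open>Any bound on \<open>U\<close> that is strictly positive would do; adding 1
    covers \<open>B = 0\<close> and keeps the tilt \<open>f\<close> nonnegative.\<close>
  define c where "c = B + 1"
  have B0: "B \<ge> 0" using bd[of undefined] by linarith
  then have c: "c > 0" by (simp add: c_def)
  define f where "f \<omega> = 1 + U \<omega> / c" for \<omega>
  have f_meas [measurable]: "f \<in> borel_measurable M" unfolding f_def by measurable
  have f_pos: "f \<omega> \<ge> 0" for \<omega>
    using bd[of \<omega>] c by (auto simp: f_def c_def field_simps)
  have intU: "integrable M U"
    by (rule integrable_const_bound[where B=B]) (use bd in auto)
  have intf: "integrable M f" unfolding f_def using intU by auto
  \<comment> \<open>At frequency 0 the hypothesis says that \<open>U\<close> has mean zero, so
    \<open>f\<close> has total mass one and \<open>D\<close> is a probability measure.\<close>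
  have "(CLINT \<omega>|M. of_real (U \<omega>)) = 0" using zero[of 0] by simp
  then have EU: "(LINT \<omega>|M. U \<omega>) = 0" by simp
  have Ef: "(LINT \<omega>|M. f \<omega>) = 1"
    unfolding f_def using intU EU by (simp add: prob_space)
  define D where "D = density M f"
  have prob_D: "prob_space D"
  proof
    show "emeasure D (space D) = 1"
      unfolding D_def using f_pos intf Ef
      by (simp add: emeasure_density nn_integral_eq_integral cong: nn_integral_cong)
  qed
  interpret D: prob_space D by (rule prob_D)
  have XD [measurable]: "X \<in> borel_measurable D" by (simp add: D_def)
  have r1: "real_distribution (distr D borel X)" "real_distribution (distr M borel X)"
    by (auto intro!: D.real_distribution_distr real_distribution_distr)
  have iexp_int: "integrable M (\<lambda>\<omega>. iexp (t * X \<omega>))" for t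
    by (rule integrable_const_bound[where B=1]) auto
  have U_iexp_int: "integrable M (\<lambda>\<omega>. complex_of_real (U \<omega>) * iexp (t * X \<omega>))" for t
    by (rule integrable_const_bound[where B=B]) (use bd in \<open>auto simp: norm_mult\<close>)
  have "char (distr D borel X) = char (distr M borel X)"
  proof
    fix t
    have "char (distr D borel X) t = (CLINT \<omega>|M. f \<omega> *\<^sub>R iexp (t * X \<omega>))"
      unfolding char_def D_def using f_pos
      by (simp add: integral_distr integral_density)
    also have "\<dots> = (CLINT \<omega>|M. iexp (t * X \<omega>) + (of_real (U \<omega>) * iexp (t * X \<omega>)) / of_real c)"
      by (intro Bochner_Integration.integral_cong) (auto simp: f_def scaleR_conv_of_real algebra_simps)
    also have "\<dots> = (CLINT \<omega>|M. iexp (t * X \<omega>))"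
      using iexp_int[of t] U_iexp_int[of t] zero[of t] by simp
    also have "\<dots> = char (distr M borel X) t"
      unfolding char_def by (simp add: integral_distr)
    finally show "char (distr D borel X) t = char (distr M borel X) t" .
  qed
  then have eq: "distr D borel X = distr M borel X"
    using Levy_uniqueness r1 by blast
  have ind_int: "integrable M (\<lambda>\<omega>. indicator A (X \<omega>) :: real)"
    by (rule integrable_const_bound[where B=1]) (auto simp: indicator_def)
  have Uind_int: "integrable M (\<lambda>\<omega>. U \<omega> * indicator A (X \<omega>))"
    by (rule integrable_const_bound[where B=B]) (use bd B0 in \<open>auto simp: indicator_def\<close>)
  have "(LINT \<omega>|M. indicator A (X \<omega>)) = (LINT x|distr M borel X. indicator A x :: real)"
    by (rule integral_distr[symmetric]) auto
  also have "\<dots> = (LINT x|distr D borel X. indicator A x :: real)" by (simp only: eq)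
  also have "\<dots> = (LINT \<omega>|M. f \<omega> * indicator A (X \<omega>))"
    unfolding D_def using f_pos by (subst integral_distr) (auto simp: integral_density)
  also have "\<dots> = (LINT \<omega>|M. indicator A (X \<omega>) + (U \<omega> * indicator A (X \<omega>)) / c)"
    by (intro Bochner_Integration.integral_cong) (auto simp: f_def algebra_simps)
  also have "\<dots> = (LINT \<omega>|M. indicator A (X \<omega>)) + (LINT \<omega>|M. U \<omega> * indicator A (X \<omega>)) / c"
    using ind_int Uind_int by simp
  finally show ?thesis using c by simp
qed

text \<open>The real case applies to \<open>Re U\<close> and \<open>Im U\<close> separately. Both
  are combinations of \<open>U\<close> and its conjugate, so the hypothesis is needed for the
  conjugate weight too.\<close>

lemma (in prob_space) weighted_char_zero:
  fixes X :: "'a \<Rightarrow> real" and U :: "'a \<Rightarrow> complex"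
  assumes X [measurable]: "X \<in> borel_measurable M" and U [measurable]: "U \<in> borel_measurable M"
    and bd: "\<And>\<omega>. cmod (U \<omega>) \<le> B"
    and zero: "\<And>t. (CLINT \<omega>|M. U \<omega> * iexp (t * X \<omega>)) = 0"
    and A [measurable]: "A \<in> sets borel"
  shows "(CLINT \<omega>|M. U \<omega> * indicator A (X \<omega>)) = 0"
proof -
  have int: "integrable M (\<lambda>\<omega>. U \<omega> * iexp (t * X \<omega>))" for t
    by (rule integrable_const_bound[where B=B]) (use bd in \<open>auto simp: norm_mult\<close>)
  have [measurable]: "(\<lambda>\<omega>. cnj (U \<omega>)) \<in> borel_measurable M"
    by (rule borel_measurable_continuous_on[OF _ U]) (intro continuous_intros)
  have int': "integrable M (\<lambda>\<omega>. cnj (U \<omega>) * iexp (t * X \<omega>))" for t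
    by (rule integrable_const_bound[where B=B]) (use bd in \<open>auto simp: norm_mult\<close>)
  \<comment> \<open>Conjugating the hypothesis at \<open>- t\<close> gives the one for the conjugate
    weight at \<open>t\<close>.\<close>
  have zero': "(CLINT \<omega>|M. cnj (U \<omega>) * iexp (t * X \<omega>)) = 0" for t
  proof -
    have "(CLINT \<omega>|M. cnj (U \<omega>) * iexp (t * X \<omega>)) = (CLINT \<omega>|M. cnj (U \<omega> * iexp (- t * X \<omega>)))"
      by (intro Bochner_Integration.integral_cong) (auto simp: exp_cnj)
    also have "\<dots> = cnj (CLINT \<omega>|M. U \<omega> * iexp (- t * X \<omega>))"
      by (simp add: integral_cnj del: complex_cnj_mult)
    also have "\<dots> = 0" by (simp only: zero complex_cnj_zero)
    finally show ?thesis .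
  qed
  have "(LINT \<omega>|M. Re (U \<omega>) * indicator A (X \<omega>)) = 0"
  proof (rule weighted_char_zero_real[where B=B])
    fix t
    have "(CLINT \<omega>|M. of_real (Re (U \<omega>)) * iexp (t * X \<omega>))
      = (CLINT \<omega>|M. (U \<omega> * iexp (t * X \<omega>) + cnj (U \<omega>) * iexp (t * X \<omega>)) / 2)"
      by (intro Bochner_Integration.integral_cong) (auto simp: complex_add_cnj distrib_right[symmetric])
    also have "\<dots> = 0" using int[of t] int'[of t] zero[of t] zero'[of t] by simp
    finally show "(CLINT \<omega>|M. of_real (Re (U \<omega>)) * iexp (t * X \<omega>)) = 0" .
  qed (use bd abs_Re_le_cmod order_trans in \<open>auto, blast\<close>)
  moreover have "(LINT \<omega>|M. Im (U \<omega>) * indicator A (X \<omega>)) = 0"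
  proof (rule weighted_char_zero_real[where B=B])
    fix t
    have "(CLINT \<omega>|M. of_real (Im (U \<omega>)) * iexp (t * X \<omega>))
      = (CLINT \<omega>|M. (U \<omega> * iexp (t * X \<omega>) - cnj (U \<omega>) * iexp (t * X \<omega>)) / (2 * \<i>))"
      by (intro Bochner_Integration.integral_cong) (simp_all add: complex_diff_cnj left_diff_distrib[symmetric] mult_ac)
    also have "\<dots> = 0" using int[of t] int'[of t] zero[of t] zero'[of t] by simp
    finally show "(CLINT \<omega>|M. of_real (Im (U \<omega>)) * iexp (t * X \<omega>)) = 0" .
  qed (use bd abs_Im_le_cmod order_trans in \<open>auto, blast\<close>)
  moreover have "integrable M (\<lambda>\<omega>. U \<omega> * indicator A (X \<omega>))"
    by (rule integrable_const_bound[where B=B])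
      (use bd order_trans[OF norm_ge_zero bd] in \<open>auto simp: indicator_def\<close>)
  moreover have "Re (U \<omega> * indicator A (X \<omega>)) = Re (U \<omega>) * indicator A (X \<omega>)"
    "Im (U \<omega> * indicator A (X \<omega>)) = Im (U \<omega>) * indicator A (X \<omega>)" for \<omega>
    by (auto simp: indicator_def)
  ultimately show ?thesis
    by (simp add: complex_eq_iff integral_Re[symmetric] integral_Im[symmetric] del: integral_Re integral_Im)
qed

text \<open>Exponentials are exchanged for indicators one coordinate at a time. For the coordinate
  in turn, the product of all other factors serves as a bounded complex weight, to which
  \<open>weighted_char_zero\<close> applies.\<close>

lemma (in prob_space) indep_vars_if_joint_char:
  fixes X :: "'i \<Rightarrow> 'a \<Rightarrow> real" and \<mu> :: "'i \<Rightarrow> real measure"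
  assumes I: "finite I"
    and X [measurable]: "\<And>i. i \<in> I \<Longrightarrow> X i \<in> borel_measurable M"
    and \<mu>: "\<And>i. i \<in> I \<Longrightarrow> real_distribution (\<mu> i)"
    and joint: "\<And>t. (CLINT \<omega>|M. iexp (\<Sum>i\<in>I. t i * X i \<omega>)) = (\<Prod>i\<in>I. char (\<mu> i) (t i))"
  shows "indep_vars (\<lambda>_. borel) X I" and "\<And>i. i \<in> I \<Longrightarrow> distr M borel (X i) = \<mu> i"
proof -
  \<comment> \<open>Mixed form of the factorisation: indicators on \<open>J\<close>, exponentials on
    the rest. The induction keeps \<open>t\<close> arbitrary, since the step needs the frequency at
    the new coordinate to vary.\<close>
  have *: "(CLINT \<omega>|M. (\<Prod>j\<in>J. indicator (A j) (X j \<omega>)) * iexp (\<Sum>i\<in>I - J. t i * X i \<omega>))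
      = (\<Prod>j\<in>J. of_real (measure (\<mu> j) (A j))) * (\<Prod>i\<in>I - J. char (\<mu> i) (t i))"
    if "J \<subseteq> I" "\<And>j. j \<in> I \<Longrightarrow> A j \<in> sets borel"
    for J :: "'i set" and A :: "'i \<Rightarrow> real set" and t :: "'i \<Rightarrow> real"
    using finite_subset[OF \<open>J \<subseteq> I\<close> I] \<open>J \<subseteq> I\<close>
  proof (induction J arbitrary: t rule: finite_induct)
    case empty
    then show ?case using joint by simp
  next
    case (insert a J)
    then have J: "J \<subseteq> I" "a \<in> I" "a \<notin> J" "finite J" by auto
    have A [measurable]: "\<And>j. j \<in> I \<Longrightarrow> A j \<in> sets borel" by (rule that(2))
    interpret \<mu>a: real_distribution "\<mu> a" using \<mu> J by auto
    have IJ: "I - J = insert a (I - insert a J)" using J by auto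
    \<comment> \<open>Coordinate \<open>a\<close> is being converted, while those in
      \<open>K\<close> keep their exponentials. \<open>V\<close> collects the factors without
      \<open>a\<close>, and \<open>C\<close> is the value that factorisation predicts for its
      mean.\<close>
    define K where "K = I - insert a J"
    have K: "finite K" "a \<notin> K" "K \<subseteq> I" using I by (auto simp: K_def)
    have X_J [measurable]: "\<And>j. j \<in> J \<Longrightarrow> X j \<in> borel_measurable M" "\<And>j. j \<in> K \<Longrightarrow> X j \<in> borel_measurable M"
      "X a \<in> borel_measurable M"
      and A_J [measurable]: "\<And>j. j \<in> J \<Longrightarrow> A j \<in> sets borel" "A a \<in> sets borel"
      using J K by (auto intro: X A)
    define V where "V \<omega> = (\<Prod>j\<in>J. indicator (A j) (X j \<omega>)) * iexp (\<Sum>i\<in>K. t i * X i \<omega>)" for \<omega>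
    define C where "C = (\<Prod>j\<in>J. complex_of_real (measure (\<mu> j) (A j))) * (\<Prod>i\<in>K. char (\<mu> i) (t i))"
    have V_meas [measurable]: "V \<in> borel_measurable M"
      unfolding V_def by measurable
    have V_bd: "cmod (V \<omega>) \<le> 1" for \<omega>
      unfolding V_def by (auto simp: norm_mult prod_norm[symmetric] indicator_def intro!: prod_le_1)
    have int_V: "integrable M (\<lambda>\<omega>. V \<omega> * iexp (s * X a \<omega>))" for s
      by (rule integrable_const_bound[where B=1]) (use V_bd in \<open>auto simp: norm_mult\<close>)
    have int_e: "integrable M (\<lambda>\<omega>. iexp (s * X a \<omega>))" for s
      by (rule integrable_const_bound[where B=1]) auto
    \<comment> \<open>This is the induction hypothesis with the frequency at \<open>a\<close> set to
      \<open>s\<close>.\<close>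
    have V: "(CLINT \<omega>|M. V \<omega> * iexp (s * X a \<omega>)) = C * char (\<mu> a) s" for s
    proof -
      have "(\<Sum>i\<in>I - J. (t(a := s)) i * X i \<omega>) = s * X a \<omega> + (\<Sum>i\<in>K. t i * X i \<omega>)" for \<omega>
      proof -
        have "(\<Sum>i\<in>K. (t(a := s)) i * X i \<omega>) = (\<Sum>i\<in>K. t i * X i \<omega>)"
          using K by (intro sum.cong) auto
        then show ?thesis
          unfolding IJ K_def[symmetric] using K by simp
      qed
      moreover have "(\<Prod>i\<in>I - J. char (\<mu> i) ((t(a := s)) i)) = char (\<mu> a) s * (\<Prod>i\<in>K. char (\<mu> i) (t i))"
      proof -
        have "(\<Prod>i\<in>K. char (\<mu> i) ((t(a := s)) i)) = (\<Prod>i\<in>K. char (\<mu> i) (t i))"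
          using K by (intro prod.cong) auto
        then show ?thesis
          unfolding IJ K_def[symmetric] using K by simp
      qed
      ultimately show ?thesis
        using insert.IH[OF J(1), of "t(a := s)"]
        by (simp add: V_def C_def exp_add distrib_left mult_ac)
    qed
    \<comment> \<open>With all other frequencies zero, the remaining factors of \<open>joint\<close>
      are 1 and the marginal characteristic function is left.\<close>
    have marg: "(CLINT \<omega>|M. iexp (s * X a \<omega>)) = char (\<mu> a) s" for s
    proof -
      have "(\<Sum>i\<in>I. (if i = a then s else 0) * X i \<omega>) = s * X a \<omega>" for \<omega>
        using I J by (subst sum.remove[of _ a]) auto
      moreover have "(\<Prod>i\<in>I. char (\<mu> i) (if i = a then s else 0)) = char (\<mu> a) s"
      proof -
        have "(\<Prod>i\<in>I - {a}. char (\<mu> i) (if i = a then s else 0)) = 1"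
          by (intro prod.neutral) (auto simp: real_distribution.char_zero[OF \<mu>])
        then show ?thesis using I J by (subst prod.remove[of _ a]) auto
      qed
      ultimately show ?thesis using joint[of "\<lambda>i. if i = a then s else 0"] by simp
    qed
    have distr_a: "distr M borel (X a) = \<mu> a"
    proof (rule Levy_uniqueness)
      show "char (distr M borel (X a)) = char (\<mu> a)"
        using marg by (auto simp: char_def integral_distr)
    qed (auto intro!: real_distribution_distr \<mu> J)
    \<comment> \<open>By \<open>V\<close> and \<open>marg\<close> the weights \<open>V\<close> and
      \<open>C\<close> have the same weighted characteristic function, so their difference has a
      vanishing one.\<close>
    have "(CLINT \<omega>|M. (V \<omega> - C) * indicator (A a) (X a \<omega>)) = 0"
    proof (rule weighted_char_zero[where B="1 + cmod C"])
      show "cmod (V \<omega> - C) \<le> 1 + cmod C" for \<omega>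
        using norm_triangle_ineq4[of "V \<omega>" C] V_bd[of \<omega>] by linarith
      fix s
      have "(CLINT \<omega>|M. (V \<omega> - C) * iexp (s * X a \<omega>))
        = (CLINT \<omega>|M. V \<omega> * iexp (s * X a \<omega>) - C * iexp (s * X a \<omega>))"
        by (simp add: algebra_simps)
      also have "\<dots> = 0" using int_V[of s] int_e[of s] V[of s] marg[of s] by simp
      finally show "(CLINT \<omega>|M. (V \<omega> - C) * iexp (s * X a \<omega>)) = 0" .
    qed auto
    moreover have "integrable M (\<lambda>\<omega>. V \<omega> * indicator (A a) (X a \<omega>))"
      by (rule integrable_const_bound[where B=1]) (use V_bd in \<open>auto simp: indicator_def\<close>)
    moreover have "integrable M (\<lambda>\<omega>. indicator (A a) (X a \<omega>) :: complex)"
      by (rule integrable_const_bound[where B=1]) (auto simp: indicator_def)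
    ultimately have "(CLINT \<omega>|M. V \<omega> * indicator (A a) (X a \<omega>)) = C * (CLINT \<omega>|M. indicator (A a) (X a \<omega>))"
      by (simp add: left_diff_distrib)
    also have "(CLINT \<omega>|M. indicator (A a) (X a \<omega>)) = (CLINT x|distr M borel (X a). indicator (A a) x)"
      by (simp add: integral_distr)
    also have "\<dots> = (CLINT x|\<mu> a. complex_of_real (indicator (A a) x))"
      unfolding distr_a by (intro Bochner_Integration.integral_cong) (auto simp: indicator_def)
    also have "\<dots> = of_real (measure (\<mu> a) (A a))"
      by (subst integral_complex_of_real) (simp add: \<mu>a.events_eq_borel)
    finally show ?case
      unfolding V_def C_def K_def using J by (simp add: mult_ac)
  qed
  have prod: "prob (\<Inter>j\<in>J. X j -` A j \<inter> space M) = (\<Prod>j\<in>J. measure (\<mu> j) (A j))"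
    if J: "J \<subseteq> I" "J \<noteq> {}" and A [measurable]: "\<And>j. j \<in> I \<Longrightarrow> A j \<in> sets borel" for J A
  proof -
    have fJ: "finite J" using J I finite_subset by auto
    have [measurable]: "\<And>j. j \<in> J \<Longrightarrow> X j \<in> borel_measurable M" "\<And>j. j \<in> J \<Longrightarrow> A j \<in> sets borel"
      using J A by auto
    have ev: "(\<Inter>j\<in>J. X j -` A j \<inter> space M) \<in> events"
      using J fJ by (intro sets.finite_INT) (auto intro!: measurable_sets)
    have "complex_of_real (prob (\<Inter>j\<in>J. X j -` A j \<inter> space M))
      = (CLINT \<omega>|M. of_real (indicator (\<Inter>j\<in>J. X j -` A j \<inter> space M) \<omega>))"
      using ev by (subst integral_complex_of_real) simp
    also have "\<dots> = (CLINT \<omega>|M. (\<Prod>j\<in>J. indicator (A j) (X j \<omega>)))"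
    proof (intro Bochner_Integration.integral_cong refl)
      fix \<omega> assume "\<omega> \<in> space M"
      then show "complex_of_real (indicator (\<Inter>j\<in>J. X j -` A j \<inter> space M) \<omega>) = (\<Prod>j\<in>J. indicator (A j) (X j \<omega>))"
        using fJ J by (auto simp: indicator_def prod_zero_iff)
    qed
    also have "\<dots> = of_real (\<Prod>j\<in>J. measure (\<mu> j) (A j))"
    proof -
      \<comment> \<open>Frequency zero removes the coordinates outside \<open>J\<close>, which turns
        the mixed identity into a product formula for probabilities.\<close>
      have "(\<Prod>i\<in>I - J. char (\<mu> i) 0) = 1"
        by (intro prod.neutral) (auto simp: real_distribution.char_zero[OF \<mu>])
      then show ?thesis using *[of J A "\<lambda>_. 0", OF J(1) A] by simp
    qed
    finally show ?thesis by (simp only: of_real_eq_iff)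
  qed
  show distr: "distr M borel (X i) = \<mu> i" if i: "i \<in> I" for i
  proof (rule measure_eqI)
    interpret \<mu>i: real_distribution "\<mu> i" using \<mu> i by auto
    show "sets (distr M borel (X i)) = sets (\<mu> i)" by simp
    fix S assume "S \<in> sets (distr M borel (X i))"
    then have S: "S \<in> sets borel" by simp
    have "prob (X i -` S \<inter> space M) = measure (\<mu> i) S"
      using prod[of "{i}" "\<lambda>_. S"] i S by simp
    then show "emeasure (distr M borel (X i)) S = emeasure (\<mu> i) S"
      using i S by (simp add: emeasure_distr emeasure_eq_measure \<mu>i.emeasure_eq_measure)
  qed
  show "indep_vars (\<lambda>_. borel) X I"
  proof (cases "I = {}")
    case True
    then show ?thesis by (simp add: indep_vars_def2 indep_sets_def)
  next
    case False
    show ?thesis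
    \<comment> \<open>The Borel sets serve as their own intersection-stable generator, so
      \<open>prod\<close> covers every event of the criterion.\<close>
    proof (subst indep_vars_finite[where E="\<lambda>_. sets borel"])
      show "\<forall>A\<in>I \<rightarrow> sets borel. prob (\<Inter>j\<in>I. X j -` A j \<inter> space M) = (\<Prod>j\<in>I. prob (X j -` A j \<inter> space M))"
      proof
        fix A assume "A \<in> I \<rightarrow> sets (borel :: real measure)"
        then have A: "\<And>j. j \<in> I \<Longrightarrow> A j \<in> sets borel" by auto
        have "prob (X j -` A j \<inter> space M) = measure (\<mu> j) (A j)" if "j \<in> I" for j
          using prod[of "{j}" A] that A by simp
        then show "prob (\<Inter>j\<in>I. X j -` A j \<inter> space M) = (\<Prod>j\<in>I. prob (X j -` A j \<inter> space M))"
          using prod[of I A] False A by simp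
      qed
    qed (use I False sets.sigma_sets_eq[of borel] sets.Int_stable[of borel] in auto)
  qed
qed

subsection \<open>Circular Gaussian random variables\<close>

lemma emeasure_disc:
  "emeasure lborel {z :: real \<times> real. (fst z)\<^sup>2 + (snd z)\<^sup>2 < r} = ennreal (pi * max 0 r)"
proof (cases "r \<ge> 0")
  case True
  have "(fst z)\<^sup>2 + (snd z)\<^sup>2 < r \<longleftrightarrow> norm z < sqrt r" for z :: "real \<times> real"
    by (simp add: norm_prod_def)
  then have "{z :: real \<times> real. (fst z)\<^sup>2 + (snd z)\<^sup>2 < r} = ball 0 (sqrt r)"
    by (auto simp: ball_def dist_norm)
  then show ?thesis
    using True by (simp add: emeasure_ball unit_ball_vol_2)
next
  case False
  then have "{z :: real \<times> real. (fst z)\<^sup>2 + (snd z)\<^sup>2 < r} = {}"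
    by (auto simp: not_less intro: order_trans[of r 0])
  then show ?thesis using False by simp
qed

text \<open>The sign makes all upper rays have finite measure.\<close>
lemma distr_minus_norm_square_plane:
  "distr lborel borel (\<lambda>z :: real \<times> real. - (fst z)\<^sup>2 - (snd z)\<^sup>2) = density lborel (\<lambda>u. ennreal (pi * indicator {..0} u))"
  (is "?L = ?R")
proof (rule measure_eqI_lessThan)
  have [measurable]: "(\<lambda>z :: real \<times> real. - (fst z)\<^sup>2 - (snd z)\<^sup>2) \<in> borel_measurable borel"
    by (intro borel_measurable_continuous_onI continuous_intros)
  \<comment> \<open>An upper ray pulls back to a disc of squared radius \<open>- x\<close>. Its area
    is linear in \<open>x\<close>, whence the constant density.\<close>
  have L: "emeasure ?L {x<..} = ennreal (pi * max 0 (- x))" for x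
  proof -
    have "(\<lambda>z :: real \<times> real. - (fst z)\<^sup>2 - (snd z)\<^sup>2) -` {x<..} = {z. (fst z)\<^sup>2 + (snd z)\<^sup>2 < - x}"
      by auto
    then show ?thesis by (simp add: emeasure_distr emeasure_disc)
  qed
  show "emeasure ?L {x<..} < \<infinity>" for x by (simp add: L)
  show "emeasure ?L {x<..} = emeasure ?R {x<..}" for x
  proof -
    have "emeasure ?R {x<..} = (\<integral>\<^sup>+u. ennreal pi * indicator {x<..0} u \<partial>lborel)"
      by (simp add: emeasure_density) (intro nn_integral_cong, auto simp: indicator_def)
    also have "\<dots> = ennreal pi * emeasure lborel {x<..0}"
      by (simp add: nn_integral_cmult_indicator)
    also have "\<dots> = ennreal (pi * max 0 (- x))"
      by (cases "x \<le> 0") (auto simp: ennreal_mult'[symmetric] max_def)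
    finally show ?thesis by (simp add: L)
  qed
qed auto

text \<open>The joint density is radial: it is a function of \<open>- x\<^sup>2 - y\<^sup>2\<close>
  alone, so integrals against it can be moved to the half-line.\<close>

lemma normal_density_product:
  assumes "s > 0"
  shows "normal_density 0 (sqrt (s / 2)) x * normal_density 0 (sqrt (s / 2)) y
    = exp ((- x\<^sup>2 - y\<^sup>2) / s) / (pi * s)"
proof -
  have "normal_density 0 (sqrt (s / 2)) x = exp (- x\<^sup>2 / s) / sqrt (pi * s)" for x
    using assms by (simp add: normal_density_def)
  then show ?thesis
    using assms by (simp add: exp_add[symmetric] add_divide_distrib diff_divide_distrib)
qed

text \<open>Pushing the radial density forward along the negated squared norm multiplies it by the
  constant \<open>pi\<close> on the negative half-line. What results, up to reflection, is the
  exponential density of mean \<open>s\<close>.\<close>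

lemma (in prob_space) cgauss_norm_square_tail:
  assumes X: "cgauss M X s" and s: "s > 0" and u: "u \<ge> 0"
  shows "prob {\<omega> \<in> space M. (cmod (X \<omega>))\<^sup>2 \<ge> u} = exp (- u / s)"
proof -
  let ?d = "normal_density 0 (sqrt (s / 2))"
  let ?q = "\<lambda>z :: real \<times> real. - (fst z)\<^sup>2 - (snd z)\<^sup>2"
  define g where "g v = ennreal (exp (v / s) / (pi * s))" for v
  have g_meas [measurable]: "g \<in> borel_measurable borel" unfolding g_def by measurable
  have q_meas [measurable]: "?q \<in> borel_measurable borel"
    by (intro borel_measurable_continuous_onI continuous_intros)
  have "distributed M (lborel \<Otimes>\<^sub>M lborel) (\<lambda>\<omega>. (Re (X \<omega>), Im (X \<omega>)))
      (\<lambda>(x, y). ennreal (?d x) * ennreal (?d y))"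
    using X unfolding cgauss_def
    by (intro distributed_joint_indep sigma_finite_lborel) (auto simp: indep_var_eq)
  then have D: "distributed M lborel (\<lambda>\<omega>. (Re (X \<omega>), Im (X \<omega>))) (\<lambda>z. g (?q z))"
  proof -
    have "(\<lambda>(x, y). ennreal (?d x) * ennreal (?d y)) = (\<lambda>z. g (?q z))"
    proof
      fix z :: "real \<times> real"
      obtain x y where z: "z = (x, y)" by (cases z)
      have "ennreal (?d x) * ennreal (?d y) = ennreal (?d x * ?d y)"
        by (simp add: ennreal_mult' normal_density_nonneg)
      also have "\<dots> = g (?q z)" unfolding normal_density_product[OF s] g_def z by simp
      finally show "(case z of (x, y) \<Rightarrow> ennreal (?d x) * ennreal (?d y)) = g (?q z)" by (simp add: z)
    qed
    then show "distributed M (lborel \<Otimes>\<^sub>M lborel) (\<lambda>\<omega>. (Re (X \<omega>), Im (X \<omega>)))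
      (\<lambda>(x, y). ennreal (?d x) * ennreal (?d y)) \<Longrightarrow> ?thesis"
      by (simp add: lborel_prod)
  qed
  have set: "{z. ?q z \<le> - u} \<in> sets lborel" by measurable
  have "{\<omega> \<in> space M. (cmod (X \<omega>))\<^sup>2 \<ge> u} = (\<lambda>\<omega>. (Re (X \<omega>), Im (X \<omega>))) -` {z. ?q z \<le> - u} \<inter> space M"
    by (auto simp: cmod_power2)
  then have "emeasure M {\<omega> \<in> space M. (cmod (X \<omega>))\<^sup>2 \<ge> u}
    = (\<integral>\<^sup>+z. g (?q z) * indicator {z. ?q z \<le> - u} z \<partial>lborel)"
    using distributed_emeasure[OF D set] by simp
  also have "\<dots> = (\<integral>\<^sup>+z. g (?q z) * indicator {..- u} (?q z) \<partial>lborel)"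
    by (intro nn_integral_cong) (auto simp: indicator_def)
  also have "\<dots> = (\<integral>\<^sup>+v. g v * indicator {..- u} v \<partial>distr lborel borel ?q)"
    by (subst nn_integral_distr) auto
  also have "\<dots> = (\<integral>\<^sup>+v. ennreal (pi * indicator {..0} v) * (g v * indicator {..- u} v) \<partial>lborel)"
    unfolding distr_minus_norm_square_plane by (subst nn_integral_density) auto
  \<comment> \<open>As \<open>u\<close> is nonnegative, the ray up to \<open>- u\<close> lies in the
    support of the image measure, and the two factors \<open>pi\<close> cancel.\<close>
  also have "\<dots> = (\<integral>\<^sup>+v. ennreal (exp (v / s) / s) * indicator {..- u} v \<partial>lborel)"
  proof (intro nn_integral_cong)
    fix v
    have "pi * (exp (v / s) / (pi * s)) = exp (v / s) / s" by simp
    then show "ennreal (pi * indicator {..0} v) * (g v * indicator {..- u} v)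
      = ennreal (exp (v / s) / s) * indicator {..- u} v"
      using u s by (auto simp: indicator_def g_def ennreal_mult'[symmetric])
  qed
  also have "\<dots> = (\<integral>\<^sup>+v. ennreal (exp (- v / s) / s) * indicator {u..} v \<partial>lborel)"
    by (subst nn_integral_real_affine[where c="-1" and t=0])
      (auto simp: indicator_def intro!: nn_integral_cong)
  also have "\<dots> = ennreal (0 - (- exp (- u / s)))"
  proof (rule nn_integral_FTC_atLeast)
    show "((\<lambda>v. - exp (- v / s)) has_real_derivative exp (- v / s) / s) (at v)" for v
      using s by (auto intro!: derivative_eq_intros)
    have "filterlim (\<lambda>v. - v / s) at_bot at_top"
      using s by real_asymp
    then have "((\<lambda>v. exp (- v / s)) \<longlongrightarrow> 0) at_top"
      by (rule filterlim_compose[OF exp_at_bot])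
    then show "((\<lambda>v. - exp (- v / s)) \<longlongrightarrow> 0) at_top"
      using tendsto_minus by fastforce
  qed (use s in auto)
  finally show ?thesis by (simp add: emeasure_eq_measure)
qed

section \<open>Gaussian characteristic functions and orthogonal transforms\<close>

lemma (in prob_space) char_normal:
  assumes X: "distributed M lborel X (normal_density 0 \<sigma>)" and \<sigma>: "\<sigma> > 0"
  shows "char (distr M borel X) t = of_real (exp (- (\<sigma> * t)\<^sup>2 / 2))"
proof -
  have "distributed M lborel (\<lambda>x. (X x - 0) / \<sigma>) std_normal_density"
    using X normal_standard_normal_convert[OF \<sigma>, of X 0] by simp
  then have D: "distr M borel (\<lambda>x. X x / \<sigma>) = std_normal_distribution"
    using distributed_distr_eq_density[of M lborel "\<lambda>x. X x / \<sigma>"] by (simp cong: distr_cong)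
  have [measurable]: "X \<in> borel_measurable M" using X distributed_measurable by fastforce
  have "char (distr M borel X) t = char (distr M borel (\<lambda>x. X x / \<sigma>)) (\<sigma> * t)"
    using \<sigma> by (simp add: char_def integral_distr)
  also have "\<dots> = of_real (exp (- (\<sigma> * t)\<^sup>2 / 2))"
    unfolding D char_std_normal_distribution by simp
  finally show ?thesis .
qed

lemma (in prob_space) cgauss_measurable:
  "cgauss M X s \<Longrightarrow> X \<in> borel_measurable M"
  unfolding cgauss_def by (auto simp: borel_measurable_complex_iff indep_var_eq)

text \<open>The variable is a sum of two independent centred normals with variances adding up to
  \<open>s * (cmod d)\<^sup>2 / 2\<close>. Circularity shows in that only the modulus of
  \<open>d\<close> enters.\<close>

lemma (in prob_space) char_cgauss:
  assumes X: "cgauss M X s" and s: "s > 0"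
  shows "char (distr M borel (\<lambda>\<omega>. Re (d * X \<omega>))) t = of_real (exp (- s * (cmod d)\<^sup>2 * t\<^sup>2 / 4))"
proof -
  have [measurable]: "X \<in> borel_measurable M" using X by (rule cgauss_measurable)
  let ?\<sigma> = "sqrt (s / 2)"
  have \<sigma>: "?\<sigma> > 0" using s by simp
  have N: "distributed M lborel (\<lambda>\<omega>. Re (X \<omega>)) (normal_density 0 ?\<sigma>)"
    "distributed M lborel (\<lambda>\<omega>. Im (X \<omega>)) (normal_density 0 ?\<sigma>)"
    and ind: "indep_var borel (\<lambda>\<omega>. Re (X \<omega>)) borel (\<lambda>\<omega>. Im (X \<omega>))"
    using X by (auto simp: cgauss_def)
  have "indep_var borel ((\<lambda>x. Re d * x) \<circ> (\<lambda>\<omega>. Re (X \<omega>))) borel ((\<lambda>x. - Im d * x) \<circ> (\<lambda>\<omega>. Im (X \<omega>)))"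
    by (rule indep_var_compose[OF ind]) auto
  then have ind': "indep_var borel (\<lambda>\<omega>. Re d * Re (X \<omega>)) borel (\<lambda>\<omega>. - Im d * Im (X \<omega>))"
    by (simp add: o_def)
  have scale: "char (distr M borel (\<lambda>\<omega>. c * Y \<omega>)) t = char (distr M borel Y) (c * t)"
    if [measurable]: "Y \<in> borel_measurable M" for Y c
    by (simp add: char_def integral_distr mult_ac)
  have "(\<lambda>\<omega>. Re (d * X \<omega>)) = (\<lambda>\<omega>. Re d * Re (X \<omega>) + - Im d * Im (X \<omega>))" by auto
  then have "char (distr M borel (\<lambda>\<omega>. Re (d * X \<omega>))) t
    = char (distr M borel (\<lambda>\<omega>. Re d * Re (X \<omega>))) t * char (distr M borel (\<lambda>\<omega>. - Im d * Im (X \<omega>))) t"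
    using char_distr_add[OF ind', of t] by (simp only:)
  also have "\<dots> = of_real (exp (- (?\<sigma> * (Re d * t))\<^sup>2 / 2) * exp (- (?\<sigma> * (- Im d * t))\<^sup>2 / 2))"
    by (subst (1 2) scale) (simp_all only: char_normal[OF N(1) \<sigma>] char_normal[OF N(2) \<sigma>] of_real_mult, auto)
  also have "exp (- (?\<sigma> * (Re d * t))\<^sup>2 / 2) * exp (- (?\<sigma> * (- Im d * t))\<^sup>2 / 2) = exp (- s * (cmod d)\<^sup>2 * t\<^sup>2 / 4)"
    unfolding exp_add[symmetric] using s
    by (intro arg_cong[where f=exp]) (simp add: power_mult_distrib cmod_power2 field_simps)
  finally show ?thesis .
qed

lemma char_normal_density:
  assumes "\<sigma> > 0"
  shows "char (density lborel (normal_density 0 \<sigma>)) t = of_real (exp (- (\<sigma> * t)\<^sup>2 / 2))"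
proof -
  let ?N = "density lborel (normal_density 0 \<sigma>)"
  interpret prob_space ?N by (rule prob_space_normal_density) (use assms in auto)
  have "distr ?N borel (\<lambda>x. x) = ?N" "distr ?N lborel (\<lambda>x. x) = ?N"
    by (intro measure_eqI; simp add: emeasure_distr)+
  then show ?thesis
    using char_normal[of "\<lambda>x. x", OF _ assms] by (auto simp: distributed_def)
qed

text \<open>Every real linear functional of the outputs is the real part of a complex combination of
  the inputs. Its characteristic function depends only on the squared norm of the coefficients,
  which orthogonal rows of squared norm \<open>C\<close> turn into \<open>C\<close> times the
  squared norm of the frequencies. So the joint characteristic function factorises.\<close>

lemma (in prob_space) cgauss_orthogonal_transform:
  fixes Z :: "'i \<Rightarrow> 'a \<Rightarrow> complex" and u :: "'j \<Rightarrow> 'i \<Rightarrow> complex"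
  assumes I: "finite I" and J: "finite J"
    and ind: "indep_vars (\<lambda>_. borel) Z I" and Z: "\<And>i. i \<in> I \<Longrightarrow> cgauss M (Z i) s"
    and s: "s > 0" and C: "C > 0"
    and orth: "\<And>j j'. j \<in> J \<Longrightarrow> j' \<in> J \<Longrightarrow>
      (\<Sum>i\<in>I. u j i * cnj (u j' i)) = (if j = j' then of_real C else 0)"
  shows "indep_vars (\<lambda>_. borel) (\<lambda>j \<omega>. \<Sum>i\<in>I. u j i * Z i \<omega>) J"
    and "\<And>j. j \<in> J \<Longrightarrow> cgauss M (\<lambda>\<omega>. \<Sum>i\<in>I. u j i * Z i \<omega>) (C * s)"
proof -
  define w where "w j \<omega> = (\<Sum>i\<in>I. u j i * Z i \<omega>)" for j \<omega>
  \<comment> \<open>The real coordinates of the outputs, indexed by pairs: \<open>True\<close> marks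
    the real part, \<open>False\<close> the imaginary part.\<close>
  define V where "V p \<omega> = (if snd p then Re (w (fst p) \<omega>) else Im (w (fst p) \<omega>))" for p \<omega>
  define \<sigma> where "\<sigma> = sqrt (C * s / 2)"
  have \<sigma>: "\<sigma> > 0" "\<sigma>\<^sup>2 = C * s / 2" using s C by (auto simp: \<sigma>_def)
  let ?N = "density lborel (normal_density 0 \<sigma>)"
  have Z_meas [measurable]: "\<And>i. i \<in> I \<Longrightarrow> Z i \<in> borel_measurable M"
    using Z cgauss_measurable by blast
  have w_meas [measurable]: "w j \<in> borel_measurable M" for j
    unfolding w_def by measurable
  have V_meas [measurable]: "V p \<in> borel_measurable M" for p
    unfolding V_def by (cases "snd p") auto
  have joint: "(CLINT \<omega>|M. iexp (\<Sum>p\<in>J \<times> UNIV. t p * V p \<omega>)) = (\<Prod>p\<in>J \<times> UNIV. char ?N (t p))" for t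
  proof -
    \<comment> \<open>The two real frequencies at \<open>j\<close> are packed into one complex
      number, so that their pairing with \<open>w j\<close> is the real part of
      \<open>cnj (c j) * w j\<close>. Collecting the terms by input gives the coefficients
      \<open>d\<close>.\<close>
    define c where "c j = Complex (t (j, True)) (t (j, False))" for j
    define d where "d i = (\<Sum>j\<in>J. cnj (c j) * u j i)" for i
    have "(\<Sum>p\<in>J \<times> UNIV. t p * V p \<omega>) = (\<Sum>i\<in>I. Re (d i * Z i \<omega>))" for \<omega>
    proof -
      have "(\<Sum>p\<in>J \<times> UNIV. t p * V p \<omega>) = (\<Sum>j\<in>J. \<Sum>b\<in>UNIV. t (j, b) * V (j, b) \<omega>)"
        by (simp add: sum.cartesian_product)
      also have "\<dots> = (\<Sum>j\<in>J. Re (cnj (c j) * w j \<omega>))"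
        by (simp add: UNIV_bool V_def c_def add.commute)
      also have "\<dots> = Re (\<Sum>j\<in>J. \<Sum>i\<in>I. cnj (c j) * u j i * Z i \<omega>)"
        unfolding w_def by (simp only: Re_sum sum_distrib_left mult.assoc)
      also have "\<dots> = Re (\<Sum>i\<in>I. d i * Z i \<omega>)"
        unfolding d_def by (subst sum.swap) (simp only: sum_distrib_right)
      finally show ?thesis by (simp only: Re_sum)
    qed
    \<comment> \<open>The frequencies are absorbed into \<open>d\<close>, so the characteristic
      function is taken at 1.\<close>
    then have "(CLINT \<omega>|M. iexp (\<Sum>p\<in>J \<times> UNIV. t p * V p \<omega>))
      = char (distr M borel (\<lambda>\<omega>. \<Sum>i\<in>I. Re (d i * Z i \<omega>))) 1"
      by (simp add: char_def integral_distr)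
    also have "\<dots> = (\<Prod>i\<in>I. char (distr M borel (\<lambda>\<omega>. Re (d i * Z i \<omega>))) 1)"
    proof (rule char_distr_sum)
      show "indep_vars (\<lambda>i. borel) (\<lambda>i \<omega>. Re (d i * Z i \<omega>)) I"
        by (rule indep_vars_compose2[OF ind, where Y="\<lambda>i z. Re (d i * z)"]) measurable
    qed
    also have "\<dots> = (\<Prod>i\<in>I. of_real (exp (- s * (cmod (d i))\<^sup>2 * 1\<^sup>2 / 4)))"
      using Z s by (intro prod.cong char_cgauss) auto
    also have "\<dots> = of_real (exp (- s * (\<Sum>i\<in>I. (cmod (d i))\<^sup>2) / 4))"
      using I by (simp add: exp_sum[symmetric] sum_distrib_left sum_divide_distrib sum_negf flip: of_real_prod)
    \<comment> \<open>Parseval's identity: in the expanded triple sum the sum over \<open>i\<close>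
      goes innermost, where \<open>orth\<close> kills the off-diagonal terms.\<close>
    also have "(\<Sum>i\<in>I. (cmod (d i))\<^sup>2) = C * (\<Sum>j\<in>J. (cmod (c j))\<^sup>2)"
    proof -
      have "complex_of_real (\<Sum>i\<in>I. (cmod (d i))\<^sup>2) = (\<Sum>i\<in>I. d i * cnj (d i))"
        by (simp only: of_real_sum complex_norm_square)
      also have "\<dots> = (\<Sum>i\<in>I. \<Sum>j\<in>J. \<Sum>j'\<in>J. (cnj (c j) * u j i) * cnj (cnj (c j') * u j' i))"
        unfolding d_def by (simp only: cnj_sum sum_product)
      also have "\<dots> = (\<Sum>j\<in>J. \<Sum>j'\<in>J. \<Sum>i\<in>I. (cnj (c j) * u j i) * cnj (cnj (c j') * u j' i))"
        by (subst sum.swap, intro sum.cong refl, rule sum.swap)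
      also have "\<dots> = (\<Sum>j\<in>J. \<Sum>j'\<in>J. cnj (c j) * c j' * (\<Sum>i\<in>I. u j i * cnj (u j' i)))"
        by (simp add: sum_distrib_left mult_ac)
      also have "\<dots> = (\<Sum>j\<in>J. \<Sum>j'\<in>J. if j = j' then cnj (c j) * c j * of_real C else 0)"
        by (intro sum.cong refl) (auto simp: orth)
      also have "\<dots> = (\<Sum>j\<in>J. cnj (c j) * c j * of_real C)"
        using J by simp
      also have "\<dots> = of_real (C * (\<Sum>j\<in>J. (cmod (c j))\<^sup>2))"
        by (simp only: of_real_mult of_real_sum complex_norm_square sum_distrib_left mult_ac)
      finally show ?thesis by (simp only: of_real_eq_iff)
    qed
    also have "of_real (exp (- s * (C * (\<Sum>j\<in>J. (cmod (c j))\<^sup>2)) / 4))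
      = complex_of_real (\<Prod>p\<in>J \<times> UNIV. exp (- (\<sigma> * t p)\<^sup>2 / 2))"
    proof -
      have "(\<Sum>p\<in>J \<times> UNIV. - (\<sigma> * t p)\<^sup>2 / 2) = (\<Sum>j\<in>J. \<Sum>b\<in>UNIV. - (\<sigma> * t (j, b))\<^sup>2 / 2)"
        by (simp add: sum.cartesian_product)
      also have "\<dots> = (\<Sum>j\<in>J. - s * (C * (cmod (c j))\<^sup>2) / 4)"
        by (simp add: UNIV_bool c_def cmod_power2 power_mult_distrib \<sigma> field_simps)
      also have "\<dots> = - s * (C * (\<Sum>j\<in>J. (cmod (c j))\<^sup>2)) / 4"
        by (simp add: sum_distrib_left sum_divide_distrib sum_negf)
      finally show ?thesis using J by (simp only: exp_sum[symmetric] finite_cartesian_product finite)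
    qed
    also have "\<dots> = (\<Prod>p\<in>J \<times> UNIV. char ?N (t p))"
      by (simp add: char_normal_density[OF \<sigma>(1)])
    finally show ?thesis .
  qed
  have fin: "finite (J \<times> (UNIV :: bool set))" using J by simp
  have real_N: "real_distribution ?N"
    using prob_space_normal_density[of \<sigma> 0] \<sigma>
    by (auto simp: real_distribution_def real_distribution_axioms_def)
  have V_ind: "indep_vars (\<lambda>_. borel) V (J \<times> UNIV)"
    and V_distr: "\<And>p. p \<in> J \<times> UNIV \<Longrightarrow> distr M borel (V p) = ?N"
    using indep_vars_if_joint_char[of "J \<times> UNIV" V "\<lambda>_. ?N", OF fin V_meas real_N joint] by auto
  \<comment> \<open>Independence of real coordinates becomes independence of complex outputs by
    grouping the two coordinates of each \<open>j\<close> into a block and rebuilding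
    \<open>w j\<close> from it.\<close>
  have "indep_vars (\<lambda>j. PiM ({j} \<times> UNIV) (\<lambda>_. borel)) (\<lambda>j \<omega>. restrict (\<lambda>p. V p \<omega>) ({j} \<times> UNIV)) J"
    by (rule indep_vars_restrict[OF V_ind]) (auto simp: disjoint_family_on_def)
  then have "indep_vars (\<lambda>_. borel)
    (\<lambda>j \<omega>. (\<lambda>f. Complex (f (j, True)) (f (j, False))) (restrict (\<lambda>p. V p \<omega>) ({j} \<times> UNIV))) J"
  proof (rule indep_vars_compose2[where Y="\<lambda>j f. Complex (f (j, True)) (f (j, False))"])
    show "(\<lambda>f. Complex (f (j, True)) (f (j, False))) \<in> borel_measurable (PiM ({j} \<times> UNIV) (\<lambda>_. borel))" for j :: 'j
      by (simp add: borel_measurable_complex_iff measurable_component_singleton)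
  qed
  moreover have "Complex (V (j, True) \<omega>) (V (j, False) \<omega>) = w j \<omega>" for j \<omega>
    by (simp add: V_def)
  ultimately show "indep_vars (\<lambda>_. borel) (\<lambda>j \<omega>. \<Sum>i\<in>I. u j i * Z i \<omega>) J"
    by (simp add: w_def)
  show "cgauss M (\<lambda>\<omega>. \<Sum>i\<in>I. u j i * Z i \<omega>) (C * s)" if j: "j \<in> J" for j
    unfolding cgauss_def w_def[symmetric] \<sigma>_def[symmetric]
  proof (intro conjI)
    have D: "distributed M lborel (V (j, b)) (normal_density 0 \<sigma>)" for b
      using V_distr[of "(j, b)"] j unfolding distributed_def by (simp cong: distr_cong)
    show "distributed M lborel (\<lambda>\<omega>. Re (w j \<omega>)) (normal_density 0 \<sigma>)"
      using D[of True] by (simp add: V_def[abs_def])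
    show "distributed M lborel (\<lambda>\<omega>. Im (w j \<omega>)) (normal_density 0 \<sigma>)"
      using D[of False] by (simp add: V_def[abs_def])
    \<comment> \<open>Within one output, the two parts come from the disjoint index sets
      \<open>{(j, True)}\<close> and \<open>{(j, False)}\<close>.\<close>
    have "indep_var borel ((\<lambda>f. f (j, True)) \<circ> (\<lambda>\<omega>. restrict (\<lambda>p. V p \<omega>) {(j, True)}))
      borel ((\<lambda>f. f (j, False)) \<circ> (\<lambda>\<omega>. restrict (\<lambda>p. V p \<omega>) {(j, False)}))"
      using j by (intro indep_var_compose[OF indep_var_restrict[OF V_ind]])
        (auto intro!: measurable_component_singleton)
    then show "indep_var borel (\<lambda>\<omega>. Re (w j \<omega>)) borel (\<lambda>\<omega>. Im (w j \<omega>))"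
      by (simp add: o_def V_def[abs_def])
  qed
qed

text \<open>The complement says that all squared moduli stay below \<open>u\<close>; by independence
  its probability is a power of the single-sample one.\<close>

lemma (in prob_space) cgauss_Max_norm_square_tail:
  fixes w :: "'i \<Rightarrow> 'a \<Rightarrow> complex"
  assumes R: "finite R" "R \<noteq> {}" and ind: "indep_vars (\<lambda>_. borel) w R"
    and w: "\<And>r. r \<in> R \<Longrightarrow> cgauss M (w r) s" and s: "s > 0" and u: "u \<ge> 0"
  shows "prob {\<omega> \<in> space M. u \<le> (MAX r\<in>R. (cmod (w r \<omega>))\<^sup>2)} = 1 - (1 - exp (- u / s)) ^ card R"
proof -
  let ?S = "{z :: complex. (cmod z)\<^sup>2 < u}"
  have S [measurable]: "?S \<in> sets borel" by measurable
  have [measurable]: "\<And>r. r \<in> R \<Longrightarrow> w r \<in> borel_measurable M"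
    using w cgauss_measurable by blast
  have single: "prob (w r -` ?S \<inter> space M) = 1 - exp (- u / s)" if [simp]: "r \<in> R" for r
  proof -
    have "w r -` ?S \<inter> space M = space M - {\<omega> \<in> space M. (cmod (w r \<omega>))\<^sup>2 \<ge> u}" by auto
    moreover have "{\<omega> \<in> space M. (cmod (w r \<omega>))\<^sup>2 \<ge> u} \<in> events" by measurable
    ultimately show ?thesis
      using prob_compl cgauss_norm_square_tail[OF w s u] by simp
  qed
  have "prob (\<Inter>r\<in>R. w r -` ?S \<inter> space M) = (1 - exp (- u / s)) ^ card R"
    using indep_varsD_finite[OF ind R(2,1), of "\<lambda>_. ?S"] single S by simp
  moreover have "(\<Inter>r\<in>R. w r -` ?S \<inter> space M) \<in> events"
    using R by (intro sets.finite_INT) (auto intro!: measurable_sets[OF _ S])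
  moreover have "{\<omega> \<in> space M. u \<le> (MAX r\<in>R. (cmod (w r \<omega>))\<^sup>2)} = space M - (\<Inter>r\<in>R. w r -` ?S \<inter> space M)"
    using R by (auto simp: Max_ge_iff simp flip: not_less)
  ultimately show ?thesis using prob_compl by simp
qed

subsection \<open>Orthogonality of the pulses and of the discrete Fourier transform\<close>

text \<open>For nonzero \<open>d\<close> this is a geometric sum whose ratio is an
  \<open>N\<close>-th root of unity. The ratio differs from 1 because \<open>N\<close> cannot divide
  a nonzero integer smaller in modulus.\<close>

lemma sum_roots_of_unity:
  fixes d :: int
  assumes "\<bar>d\<bar> < int N"
  shows "(\<Sum>n<N. exp (\<i> * of_real (2 * pi * (real n * of_int d / real N)))) = (if d = 0 then of_nat N else 0)"
proof (cases "d = 0")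
  case False
  have N: "N > 0" using assms by linarith
  define z where "z = exp (\<i> * complex_of_real (2 * pi * of_int d / real N))"
  have pow: "exp (\<i> * complex_of_real (2 * pi * (real n * of_int d / real N))) = z ^ n" for n
    unfolding z_def exp_of_nat_mult[symmetric] by (simp add: mult_ac)
  have "z ^ N = 1"
    unfolding pow[symmetric] using N by (auto simp: exp_eq_1)
  moreover have "z \<noteq> 1"
  proof
    assume "z = 1"
    then obtain k :: int where "2 * pi * of_int d / real N = of_int (2 * k) * pi"
      unfolding z_def exp_eq_1 by auto
    then have "real_of_int d = real_of_int (k * int N)" using N by (simp add: field_simps)
    then have "d = k * int N" by (simp only: of_int_eq_iff)
    then have "int N dvd d" by simp
    then show False using assms False zdvd_imp_le[of "int N" "\<bar>d\<bar>"] by auto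
  qed
  ultimately show ?thesis
    using False geometric_sum[of z N] by (simp only: pow) simp
qed simp

text \<open>Over an interval of length \<open>T\<close> the phase advances by
  \<open>2 * pi * d\<close>, so the antiderivative returns to its value unless \<open>d = 0\<close>,
  where it is linear instead.\<close>

lemma harmonic_integral_period:
  fixes d :: int and n :: nat
  assumes T: "T > 0"
  shows "has_bochner_integral lborel
    (\<lambda>t. indicator {real n * T..(real n + 1) * T} t *\<^sub>R (exp (\<i> * of_real (2 * pi * of_int d / T * t)) / of_real T))
    (if d = 0 then 1 else 0)"
proof -
  let ?a = "real n * T" and ?b = "(real n + 1) * T"
  define c where "c = 2 * pi * of_int d / T"
  define F where "F t = (if d = 0 then of_real (t / T) else exp (\<i> * of_real (c * t)) / (\<i> * of_real c * of_real T))" for t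
  have c: "d \<noteq> 0 \<Longrightarrow> c \<noteq> 0" "d = 0 \<Longrightarrow> c = 0" using T by (auto simp: c_def)
  have "has_bochner_integral lborel
    (\<lambda>t. indicator {?a..?b} t *\<^sub>R (exp (\<i> * of_real (c * t)) / of_real T)) (F ?b - F ?a)"
  proof (rule has_bochner_integral_FTC_Icc)
    show "?a \<le> ?b" using T by simp
    show "(F has_vector_derivative exp (\<i> * of_real (c * t)) / of_real T) (at t within {?a..?b})" for t
    proof (cases "d = 0")
      case True
      have "((\<lambda>t. complex_of_real (t / T)) has_vector_derivative of_real (1 / T)) (at t within {?a..?b})"
        by (rule has_vector_derivative_of_real) (use T in \<open>auto intro!: derivative_eq_intros\<close>)
      moreover have "F = (\<lambda>t. of_real (t / T))" using True by (auto simp: F_def)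
      ultimately show ?thesis using True c by simp
    next
      case False
      have "((\<lambda>z. exp (\<i> * (of_real c * z)) / (\<i> * of_real c * of_real T)) has_field_derivative
          exp (\<i> * (of_real c * of_real t)) / of_real T) (at (of_real t))"
        using False c T by (auto intro!: derivative_eq_intros)
      then have "((\<lambda>t. exp (\<i> * (of_real c * of_real t)) / (\<i> * of_real c * of_real T)) has_vector_derivative
          exp (\<i> * (of_real c * of_real t)) / of_real T) (at t within {?a..?b})"
        by (rule has_vector_derivative_real_field)
      moreover have "F = (\<lambda>t. exp (\<i> * (of_real c * of_real t)) / (\<i> * of_real c * of_real T))"
        using False by (auto simp: F_def)
      ultimately show ?thesis by simp
    qed
    show "continuous_on {?a..?b} (\<lambda>t. exp (\<i> * of_real (c * t)) / complex_of_real T)"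
      using T by (intro continuous_intros) auto
  qed
  moreover have "F ?b - F ?a = (if d = 0 then 1 else 0)"
  proof (cases "d = 0")
    case True
    have "F ?b - F ?a = of_real (?b / T - ?a / T)" using True by (simp add: F_def)
    also have "?b / T - ?a / T = 1" using T by (simp add: field_simps)
    finally show ?thesis using True by simp
  next
    case False
    have "c * ?b = c * ?a + 2 * of_int d * pi" using T by (simp add: c_def field_simps)
    then have "exp (\<i> * complex_of_real (c * ?b)) = exp (\<i> * complex_of_real (c * ?a))"
      unfolding exp_eq by (intro exI[of _ d]) (simp add: algebra_simps)
    then show ?thesis using False unfolding F_def by (simp only: if_False diff_self)
  qed
  ultimately show ?thesis by (simp add: c_def)
qed

text \<open>The function projected onto in \<open>Wtf\<close>. Its exponent is positive since
  \<open>nf\<close> stands for integration against the conjugate.\<close>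

definition tf_pulse :: "real \<Rightarrow> nat \<Rightarrow> nat \<Rightarrow> real \<Rightarrow> complex" where
  "tf_pulse T n m t = indicator {real n * T .. (real n + 1) * T} t *
     exp (\<i> * complex_of_real (2 * pi * real m * (1 / T) * t)) / complex_of_real (sqrt T)"

text \<open>In the same time slot the product is a harmonic of index \<open>m - m'\<close> over one
  period. Pulses of different slots overlap in at most an endpoint, a null set.\<close>

lemma tf_pulse_orthonormal:
  assumes T: "T > 0"
  shows "has_bochner_integral lborel (\<lambda>t. tf_pulse T n m t * cnj (tf_pulse T n' m' t))
    (if n = n' \<and> m = m' then 1 else 0)"
proof (cases "n = n'")
  case True
  have "tf_pulse T n m t * cnj (tf_pulse T n' m' t) =
    indicator {real n * T..(real n + 1) * T} t *\<^sub>R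
      (exp (\<i> * of_real (2 * pi * of_int (int m - int m') / T * t)) / of_real T)" for t
  proof -
    have "complex_of_real (sqrt T) * complex_of_real (sqrt T) = of_real T"
      using T by (simp flip: of_real_mult)
    moreover have "exp (\<i> * complex_of_real (2 * pi * real m * (1 / T) * t)) *
        exp (- (\<i> * complex_of_real (2 * pi * real m' * (1 / T) * t)))
      = exp (\<i> * of_real (2 * pi * of_int (int m - int m') / T * t))"
      unfolding exp_add[symmetric]
      by (intro arg_cong[where f=exp]) (simp add: algebra_simps diff_divide_distrib)
    ultimately show ?thesis
      using True by (auto simp: tf_pulse_def exp_cnj indicator_def)
  qed
  then show ?thesis
    using harmonic_integral_period[OF T, of n "int m - int m'"] True by simp
next
  case False
  \<comment> \<open>The start of the later slot, the only point that two closed slots can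
    share.\<close>
  define c where "c = (if n < n' then real n' * T else real n * T)"
  have z: "t = c" if "t \<in> {real n * T .. (real n + 1) * T}" "t \<in> {real n' * T .. (real n' + 1) * T}" for t
  proof (cases "n < n'")
    case True
    then have "(real n + 1) * T \<le> real n' * T" using T by (intro mult_right_mono) auto
    then show ?thesis using that True by (simp add: c_def)
  next
    case f: False
    then have "n' < n" using False by simp
    then have "(real n' + 1) * T \<le> real n * T" using T by (intro mult_right_mono) auto
    then show ?thesis using that f by (simp add: c_def)
  qed
  have "AE t in lborel. t \<noteq> c" by (rule AE_lborel_singleton)
  then have ae: "AE t in lborel. tf_pulse T n m t * cnj (tf_pulse T n' m' t) = 0"
    by eventually_elim (use z in \<open>auto simp: tf_pulse_def indicator_def\<close>)
  have [measurable]: "(\<lambda>t. tf_pulse T n m t) \<in> borel_measurable borel" for n m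
    unfolding tf_pulse_def by measurable
  have "(\<lambda>t. cnj (tf_pulse T n' m' t)) \<in> borel_measurable borel"
    by (rule borel_measurable_continuous_on[of cnj]) (auto intro!: continuous_intros)
  then have [measurable]: "(\<lambda>t. tf_pulse T n m t * cnj (tf_pulse T n' m' t)) \<in> borel_measurable borel"
    by measurable
  have "has_bochner_integral lborel (\<lambda>t. tf_pulse T n m t * cnj (tf_pulse T n' m' t)) 0"
    by (subst has_bochner_integral_cong_AE[where g="\<lambda>_. 0"]) (use ae in auto)
  then show ?thesis using False by simp
qed

text \<open>The kernel of \<open>wdd\<close> as a matrix: rows are DD points, columns are TF points,
  both packed as pairs.\<close>

definition dft_coeff :: "nat \<Rightarrow> nat \<Rightarrow> nat \<times> nat \<Rightarrow> nat \<times> nat \<Rightarrow> complex" where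
  "dft_coeff N M kl nm = exp (\<i> * complex_of_real (2 * pi *
     (real (snd nm) * real (snd kl) / real M - real (fst nm) * real (fst kl) / real N)))"

lemma dft_coeff_orthogonal:
  assumes "kl \<in> {..<N} \<times> {..<M}" "kl' \<in> {..<N} \<times> {..<M}"
  shows "(\<Sum>nm\<in>{..<N} \<times> {..<M}. dft_coeff N M kl nm * cnj (dft_coeff N M kl' nm))
    = (if kl = kl' then of_real (real N * real M) else 0)"
proof -
  obtain k l k' l' where kl: "kl = (k, l)" "kl' = (k', l')" by (cases kl, cases kl')
  let ?e = "\<lambda>(N::nat) (n::nat) (d::int). exp (\<i> * complex_of_real (2 * pi * (real n * of_int d / real N)))"
  \<comment> \<open>The phase splits into an \<open>n\<close> part and an \<open>m\<close> part. The
    Doppler phase carries a minus sign, hence \<open>k' - k\<close> against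
    \<open>l - l'\<close>.\<close>
  have *: "dft_coeff N M kl (n, m) * cnj (dft_coeff N M kl' (n, m)) = ?e N n (int k' - int k) * ?e M m (int l - int l')" for n m
    unfolding dft_coeff_def kl exp_cnj exp_add[symmetric]
    by (intro arg_cong[where f=exp]) (simp add: algebra_simps diff_divide_distrib)
  have "(\<Sum>nm\<in>{..<N} \<times> {..<M}. dft_coeff N M kl nm * cnj (dft_coeff N M kl' nm))
    = (\<Sum>n<N. \<Sum>m<M. ?e N n (int k' - int k) * ?e M m (int l - int l'))"
    by (simp only: sum.cartesian_product' * )
  also have "\<dots> = (\<Sum>n<N. ?e N n (int k' - int k)) * (\<Sum>m<M. ?e M m (int l - int l'))"
    by (simp only: sum_product)
  also have "\<dots> = (if kl = kl' then of_real (real N * real M) else 0)"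
    using assms by (subst (1 2) sum_roots_of_unity) (auto simp: kl)
  finally show ?thesis .
qed

subsection \<open>The false alarm threshold\<close>

theorem theorem1:
  fixes P :: "'a measure" and nf :: "(real \<Rightarrow> complex) \<Rightarrow> 'a \<Rightarrow> complex"
    and G Bc Tc No p_fa :: real and N1 q :: nat
  assumes "prob_space P"
    and "white_noise P nf No" and "No > 0"
    and "G > 0" and "Bc > 0" and "Tc > G"
    and "1 \<le> N1" and "N1 \<le> Nsz G Bc Tc" and "(q + 1) * N1 \<le> Nsz G Bc Tc"
    and "0 < p_fa" and "p_fa < 1"
  shows "PFA P nf (\<lambda>_. 1) G Bc Tc N1 q
           (- No * (1 + of_int \<lceil>G * Bc\<rceil>) * of_int \<lfloor>Bc * Tc / (1 + of_int \<lceil>G * Bc\<rceil>)\<rfloor>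
              * ln (1 - (1 - p_fa) powr (1 / (real N1 * (1 + of_int \<lceil>G * Bc\<rceil>)))))
         = p_fa"
proof -
  interpret prob_space P by fact
  define M where "M = Msz G Bc"
  define N where "N = Nsz G Bc Tc"
  define T where "T = Tsym G Bc"
  have "0 < G * Bc" using assms by simp
  then have "\<lceil>G * Bc\<rceil> > 0" by simp
  then have M: "real M = 1 + of_int \<lceil>G * Bc\<rceil>" "M > 0" by (simp_all add: M_def Msz_def del: zero_less_ceiling)
  have T: "T = real M / Bc" "T > 0" using M assms by (auto simp: T_def Tsym_def M_def)
  have N: "N > 0" using assms by (simp add: N_def)
  have "Tc / T = Bc * Tc / real M" by (simp add: T)
  moreover have "N = nat \<lfloor>Tc / T\<rfloor>" by (simp add: N_def Nsz_def T_def)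
  \<comment> \<open>Positivity of \<open>N\<close> rules out truncation by \<open>nat\<close>, so
    the real floor of the threshold formula agrees with \<open>N\<close>.\<close>
  ultimately have floor_N: "of_int \<lfloor>Bc * Tc / real M\<rfloor> = real N" using N by simp
  \<comment> \<open>White noise is specified for families indexed by natural numbers, so the TF grid
    is coded by \<open>prod_encode\<close>.\<close>
  define I where "I = prod_encode ` ({..<N} \<times> {..<M})"
  define \<phi> where "\<phi> i = (\<lambda>t. tf_pulse T (fst (prod_decode i)) (snd (prod_decode i)) t)" for i
  define R where "R = Rgrp G Bc N1 q"
  define w where "w kl \<omega> = (\<Sum>i\<in>I. dft_coeff N M kl (prod_decode i) * nf (\<phi> i) \<omega>)" for kl \<omega>
  have I: "finite I" by (simp add: I_def)
  have R_eq: "R = {q * N1..<(q + 1) * N1} \<times> {..<M}" by (auto simp: R_def Rgrp_def M_def)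
  have R: "finite R" "R \<noteq> {}" "card R = N1 * M" using M assms by (auto simp: R_eq)
  \<comment> \<open>The hypothesis on \<open>(q + 1) * N1\<close> keeps the preamble group inside
    the DD grid, where the Fourier rows are orthogonal.\<close>
  have R_sub: "kl \<in> {..<N} \<times> {..<M}" if "kl \<in> R" for kl
    using that assms(9) by (auto simp: R_eq N_def)
  have orthonormal: "integrable lborel (\<lambda>t. \<phi> i t * cnj (\<phi> j t)) \<and>
      (LINT t|lborel. \<phi> i t * cnj (\<phi> j t)) = (if i = j then 1 else 0)" for i j
  proof -
    have "fst (prod_decode i) = fst (prod_decode j) \<and> snd (prod_decode i) = snd (prod_decode j) \<longleftrightarrow> i = j"
      by (metis prod_decode_inverse prod.collapse)
    then show ?thesis
      using tf_pulse_orthonormal[OF T(2), of "fst (prod_decode i)" "snd (prod_decode i)"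
          "fst (prod_decode j)" "snd (prod_decode j)"]
      unfolding \<phi>_def has_bochner_integral_iff by simp
  qed
  then have noise: "indep_vars (\<lambda>_. borel) (\<lambda>i. nf (\<phi> i)) I" "\<And>i. i \<in> I \<Longrightarrow> cgauss P (nf (\<phi> i)) No"
    using assms(2) I unfolding white_noise_def by blast+
  have wdd_eq: "wdd nf (\<lambda>_. 1) G Bc Tc (fst kl) (snd kl) \<omega> = w kl \<omega>" for kl \<omega>
  proof -
    have "w kl \<omega> = (\<Sum>nm\<in>{..<N} \<times> {..<M}. dft_coeff N M kl nm * nf (tf_pulse T (fst nm) (snd nm)) \<omega>)"
      unfolding w_def I_def \<phi>_def
      by (subst sum.reindex) (auto simp: inj_on_def prod_encode_eq)
    also have "\<dots> = (\<Sum>n<N. \<Sum>m<M. dft_coeff N M kl (n, m) * nf (tf_pulse T n m) \<omega>)"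
      by (simp add: sum.cartesian_product')
    also have "\<dots> = wdd nf (\<lambda>_. 1) G Bc Tc (fst kl) (snd kl) \<omega>"
      unfolding wdd_def Wtf_def dfreq_def N_def[symmetric] M_def[symmetric] T_def[symmetric]
      by (simp add: dft_coeff_def tf_pulse_def[abs_def] mult.commute)
    finally show ?thesis by simp
  qed
  define s where "s = real N * real M * No"
  have s: "s > 0" using N M assms by (simp add: s_def)
  have "(\<Sum>i\<in>I. dft_coeff N M kl (prod_decode i) * cnj (dft_coeff N M kl' (prod_decode i)))
    = (if kl = kl' then of_real (real N * real M) else 0)" if "kl \<in> R" "kl' \<in> R" for kl kl'
    unfolding I_def using dft_coeff_orthogonal[OF R_sub R_sub] that
    by (subst sum.reindex) (auto simp: inj_on_def prod_encode_eq)
  then have w: "indep_vars (\<lambda>_. borel) w R" "\<And>kl. kl \<in> R \<Longrightarrow> cgauss P (w kl) s"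
    using cgauss_orthogonal_transform[OF I R(1) noise \<open>No > 0\<close>,
        of "real N * real M" "\<lambda>kl i. dft_coeff N M kl (prod_decode i)"] N M
    unfolding w_def[abs_def] s_def by auto
  \<comment> \<open>Here \<open>x\<close> is the exceedance probability of a single sample for which
    \<open>N1 * M\<close> independent ones give a false alarm probability of \<open>p_fa\<close>;
    \<open>u\<close> is the level at which the exponential tail equals \<open>x\<close>.\<close>
  define e where "e = 1 / (real N1 * real M)"
  define x where "x = 1 - (1 - p_fa) powr e"
  have e: "e > 0" using M assms by (simp add: e_def)
  then have x: "0 < x" "x < 1"
    using assms powr_less_mono2[of e "1 - p_fa" 1] by (auto simp: x_def)
  define u where "u = - s * ln x"
  \<comment> \<open>Since \<open>x\<close> lies strictly between 0 and 1, its logarithm is negative,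
    and \<open>u\<close> is in the range of the tail formula.\<close>
  have u: "u \<ge> 0" using s x by (simp add: u_def mult_le_0_iff)
  have "exp (- u / s) = x" using s x by (simp add: u_def)
  moreover have "(1 - x) ^ (N1 * M) = 1 - p_fa"
  proof -
    have "(1 - x) ^ (N1 * M) = ((1 - p_fa) powr e) powr real (N1 * M)"
      using assms powr_realpow[of "(1 - p_fa) powr e" "N1 * M"] by (simp add: x_def)
    also have "\<dots> = 1 - p_fa"
      using M assms by (simp add: powr_powr e_def)
    finally show ?thesis .
  qed
  moreover have "PFA P nf (\<lambda>_. 1) G Bc Tc N1 q u = 1 - (1 - exp (- u / s)) ^ (N1 * M)"
    unfolding PFA_def R_def[symmetric] wdd_eq
    using cgauss_Max_norm_square_tail[OF R(1,2) w s u] by (simp add: R)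
  ultimately have "PFA P nf (\<lambda>_. 1) G Bc Tc N1 q u = p_fa" by simp
  also have "u = - No * real M * of_int \<lfloor>Bc * Tc / real M\<rfloor> * ln (1 - (1 - p_fa) powr (1 / (real N1 * real M)))"
    by (simp add: u_def s_def x_def e_def floor_N)
  finally show ?thesis unfolding M(1) .
qed

end
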